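(* Let $G$ be a powerful $2$-group. Then $\Omega_i(G^{2^j})$ is powerfully nilpotent for all $i\geq 1$, $j\geq 2$. Furthermore, for $i>1$ the powerful nilpotency class of $\Omega_i(G^{2^j})$ is at most $i-1$. For $i=1$ the powerful nilpotency class is $1$.
   Context: For a group $X$ and an integer $n\ge 1$, $X^{n}$ denotes the subgroup of $X$ generated by all $n$th powers of elements of $X$. For a finite $2$-group $X$, $\Omega_i(X)$ is the subgroup generated by all elements of $X$ whose order divides $2^i$. $X'$ denotes the commutator subgroup of $X$, and for subgroups $A,B$ of $X$, $[A,B]$ denotes the subgroup generated by all commutators $[a,b]$ with $a\in A$, $b\in B$. A finite $2$-group $X$ is powerful if $X'\leq X^{4}$. A powerful $2$-group $X$ is powerfully nilpotent if it has a chain of subgroups $\{1\}=H_0\leq H_1\leq\dots\leq H_n=X$ such that $[H_k,X]\leq H_{k-1}^{2}$ for $k=1,\dots,n$. Such a chain is called a powerfully central chain (of length $n$). The powerful nilpotency class of a powerfully nilpotent group $X$ is the shortest length that a powerfully central chain of $X$ can have.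
   Formalization: For i=1 the class is stated to be 1 only when Ω_1(G^{2^j}) is nontrivial; when it is trivial (e.g. G cyclic of order 4, j=2) the class is 0, since a chain of length 0 is allowed. *)

theory Defs
  imports "HOL-Algebra.Algebra"
begin

text \<open>Powers and commutator subgroups are taken of subsets of a fixed ambient group; for a
  subgroup they agree with those computed inside the subgroup.\<close>

definition power_subgroup :: "('a, 'b) monoid_scheme \<Rightarrow> 'a set \<Rightarrow> nat \<Rightarrow> 'a set" where
  "power_subgroup G A n = generate G {a [^]\<^bsub>G\<^esub> n | a. a \<in> A}"

definition commutator_subgroup ::
    "('a, 'b) monoid_scheme \<Rightarrow> 'a set \<Rightarrow> 'a set \<Rightarrow> 'a set" where
  "commutator_subgroup G A B =
     generate G {a \<otimes>\<^bsub>G\<^esub> b \<otimes>\<^bsub>G\<^esub> inv\<^bsub>G\<^esub> a \<otimes>\<^bsub>G\<^esub> inv\<^bsub>G\<^esub> b | a b. a \<in> A \<and> b \<in> B}"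

text \<open>The groups \<open>G\<^sup>n\<close> and \<open>\<Omega>\<^sub>i(G)\<close> are structures in their own right, so that the two
  constructions can be iterated.\<close>

definition power_group :: "('a, 'b) monoid_scheme \<Rightarrow> nat \<Rightarrow> ('a, 'b) monoid_scheme" where
  "power_group G n = G\<lparr>carrier := power_subgroup G (carrier G) n\<rparr>"

definition Omega :: "nat \<Rightarrow> ('a, 'b) monoid_scheme \<Rightarrow> ('a, 'b) monoid_scheme" where
  "Omega i G = G\<lparr>carrier := generate G {x \<in> carrier G. group.ord G x dvd 2 ^ i}\<rparr>"

text \<open>Finiteness is implied, since \<open>order\<close> is 0 for infinite carriers.\<close>

definition finite_2_group :: "('a, 'b) monoid_scheme \<Rightarrow> bool" where
  "finite_2_group G \<longleftrightarrow> group G \<and> (\<exists>m. order G = 2 ^ m)"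

definition powerful_2_group :: "('a, 'b) monoid_scheme \<Rightarrow> bool" where
  "powerful_2_group G \<longleftrightarrow>
     finite_2_group G \<and> derived G (carrier G) \<subseteq> power_subgroup G (carrier G) 4"

text \<open>Only the values \<open>H 0, \<dots>, H n\<close> matter. Length \<open>n = 0\<close> is allowed, and it occurs
  exactly for the trivial group.\<close>

definition powerfully_central_chain ::
    "('a, 'b) monoid_scheme \<Rightarrow> nat \<Rightarrow> (nat \<Rightarrow> 'a set) \<Rightarrow> bool" where
  "powerfully_central_chain G n H \<longleftrightarrow>
     H 0 = {\<one>\<^bsub>G\<^esub>} \<and> H n = carrier G \<and>
     (\<forall>k \<in> {0..n}. subgroup (H k) G) \<and>
     (\<forall>k \<in> {1..n}. H (k - 1) \<subseteq> H k \<and>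
        commutator_subgroup G (H k) (carrier G) \<subseteq> power_subgroup G (H (k - 1)) 2)"

definition powerfully_nilpotent :: "('a, 'b) monoid_scheme \<Rightarrow> bool" where
  "powerfully_nilpotent G \<longleftrightarrow>
     powerful_2_group G \<and> (\<exists>n H. powerfully_central_chain G n H)"

text \<open>Meaningful only for powerfully nilpotent groups.\<close>

definition powerful_nilpotency_class :: "('a, 'b) monoid_scheme \<Rightarrow> nat" where
  "powerful_nilpotency_class G = (LEAST n. \<exists>H. powerfully_central_chain G n H)"

end

(* Write P_m for the m-th iterated subgroup of squares of a powerful 2-group G; it consists of the
   2^m-th powers, and [P_m, P_l] is contained in P_(m+l+2). The heart of the matter is the bound: if
   x in P_m and y in P_l satisfy x^(2^(n-m)) = y^(2^(n-l)) = 1 with m, l >= 1, then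
   [x,y]^(2^(n-m-l)) = 1. It is trivial for large n and is proved by descending induction on n: a
   2^r-th root of an element of depth m belongs to the same n at depth m - r, while commutators gain
   two in depth, hence land in a case with larger n. For fixed n the bound makes the elements x of P_m
   with x^(2^(n-m)) = 1 into a subgroup.
   For j >= 2 it follows that K = Omega_i(G^(2^j)) has exponent dividing 2^i, and that commutators
   of K are fourth powers of elements of K, so K is powerful. A powerful 2-group of exponent dividing
   2^i with i >= 2 has the powerfully central chain 1 <= P_(i-2) <= ... <= P_1 <= P_0 of length
   i - 1; for i = 1 the chain for i = 2 applies. *)

theory Submission
  imports Defs
begin

section \<open>Commutator identities and normal subgroups\<close>

context group begin

definition comm :: "'a \<Rightarrow> 'a \<Rightarrow> 'a" where
  "comm x y = x \<otimes> y \<otimes> inv x \<otimes> inv y"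

lemma inv_cancel [simp]:
  assumes "x \<in> carrier G" "y \<in> carrier G"
  shows "inv x \<otimes> (x \<otimes> y) = y" "x \<otimes> (inv x \<otimes> y) = y"
  using assms by (simp_all flip: m_assoc)

lemma comm_closed [simp]: "x \<in> carrier G \<Longrightarrow> y \<in> carrier G \<Longrightarrow> comm x y \<in> carrier G"
  by (simp add: comm_def)

lemma comm_one [simp]: "x \<in> carrier G \<Longrightarrow> comm x \<one> = \<one>" "x \<in> carrier G \<Longrightarrow> comm \<one> x = \<one>"
  by (simp_all add: comm_def)

lemma comm_inv: "x \<in> carrier G \<Longrightarrow> y \<in> carrier G \<Longrightarrow> inv (comm x y) = comm y x"
  by (simp add: comm_def inv_mult_group m_assoc)

text \<open>Presents [x,y] as the left factor that turns y into a conjugate of y. Since conjugates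
  have the same order, this is how \<open>left_factor_T\<close> gets to apply to
  commutators.\<close>

lemma comm_mult_conj: "x \<in> carrier G \<Longrightarrow> y \<in> carrier G \<Longrightarrow> comm x y \<otimes> y = x \<otimes> y \<otimes> inv x"
  by (simp add: comm_def m_assoc)

lemma comm_mult_left:
  "x \<in> carrier G \<Longrightarrow> y \<in> carrier G \<Longrightarrow> g \<in> carrier G \<Longrightarrow>
    comm (x \<otimes> y) g = x \<otimes> comm y g \<otimes> inv x \<otimes> comm x g"
  by (simp add: comm_def inv_mult_group m_assoc)

lemma comm_inv_left:
  "x \<in> carrier G \<Longrightarrow> g \<in> carrier G \<Longrightarrow> comm (inv x) g = inv x \<otimes> inv (comm x g) \<otimes> inv (inv x)"
  by (simp add: comm_def inv_mult_group m_assoc)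

text \<open>Squaring an argument squares the commutator, up to an error that is one commutator
  deeper. This drives the passage from a square root to the element itself.\<close>

lemma comm_square_left:
  "x \<in> carrier G \<Longrightarrow> g \<in> carrier G \<Longrightarrow>
    comm (x \<otimes> x) g = comm x (comm x g) \<otimes> (comm x g \<otimes> comm x g)"
  by (simp add: comm_def inv_mult_group m_assoc)

lemma comm_square_right:
  "x \<in> carrier G \<Longrightarrow> u \<in> carrier G \<Longrightarrow>
    comm x (u \<otimes> u) = comm x u \<otimes> comm u (comm x u) \<otimes> inv (comm x u) \<otimes> (comm x u \<otimes> comm x u)"
  by (simp add: comm_def inv_mult_group m_assoc)

lemma square_mult:
  "u \<in> carrier G \<Longrightarrow> v \<in> carrier G \<Longrightarrow>
    (u \<otimes> u) \<otimes> (v \<otimes> v) = comm u (comm u v) \<otimes> comm u v \<otimes> ((u \<otimes> v) \<otimes> (u \<otimes> v))"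
  by (simp add: comm_def inv_mult_group m_assoc)

lemma comm_in_normal:
  assumes "N \<lhd> G" "x \<in> N" "g \<in> carrier G"
  shows "comm x g \<in> N" "comm g x \<in> N"
proof -
  interpret normal N G by fact
  have x: "x \<in> carrier G" using assms by auto
  have "comm x g = x \<otimes> (g \<otimes> inv x \<otimes> inv g)" using x assms by (simp add: comm_def m_assoc)
  then show *: "comm x g \<in> N" using assms inv_op_closed2 by auto
  show "comm g x \<in> N" using * comm_inv[of x g] x assms by (metis m_inv_closed)
qed

text \<open>The set is the preimage of the centre of G/V, described without cosets. Closure under
  products holds because [xy,g] is a conjugate of [y,g] times [x,g].\<close>

lemma centralizer_mod_normal:
  assumes "V \<lhd> G"
  shows "{x \<in> carrier G. \<forall>g\<in>carrier G. comm x g \<in> V} \<lhd> G" (is "?C \<lhd> G")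
proof -
  interpret normal V G by fact
  have sub: "subgroup ?C G"
  proof (rule subgroupI)
    show "?C \<noteq> {}" using one_closed by (auto intro!: exI[of _ \<one>])
    show "inv a \<in> ?C" if "a \<in> ?C" for a
      using that comm_inv_left[of a] inv_op_closed2[of "inv a"] by (auto simp del: inv_inv)
    show "a \<otimes> b \<in> ?C" if "a \<in> ?C" "b \<in> ?C" for a b
      using that comm_mult_left[of a b] inv_op_closed2[of a] by auto
  qed auto
  have "g \<otimes> x \<otimes> inv g \<in> ?C" if "x \<in> ?C" "g \<in> carrier G" for x g
  proof -
    have "comm (g \<otimes> x \<otimes> inv g) h \<in> V" if h: "h \<in> carrier G" for h
    proof -
      have "comm (g \<otimes> x \<otimes> inv g) h = g \<otimes> comm x (inv g \<otimes> h \<otimes> g) \<otimes> inv g"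
        using \<open>x \<in> ?C\<close> \<open>g \<in> carrier G\<close> h by (simp add: comm_def inv_mult_group m_assoc)
      then show ?thesis using \<open>x \<in> ?C\<close> \<open>g \<in> carrier G\<close> h by (auto intro!: inv_op_closed2)
    qed
    then show ?thesis using that by auto
  qed
  then show ?thesis using sub by (auto simp: normal_inv_iff)
qed

lemma power_subgroup_two: "power_subgroup G A 2 = generate G {a \<otimes> a | a. a \<in> A}" if "A \<subseteq> carrier G"
proof -
  have "{a [^] (2::nat) | a. a \<in> A} = {a \<otimes> a | a. a \<in> A}"
    using that by (force simp: numeral_2_eq_2)
  then show ?thesis by (simp add: power_subgroup_def)
qed

lemma pow_conj:
  assumes "g \<in> carrier G" "x \<in> carrier G"
  shows "(g \<otimes> x \<otimes> inv g) [^] (n::nat) = g \<otimes> x [^] n \<otimes> inv g"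
  by (induction n) (use assms in \<open>simp_all add: m_assoc\<close>)

lemma power_subgroup_normal:
  assumes "N \<lhd> G" shows "power_subgroup G N n \<lhd> G"
proof -
  interpret normal N G by fact
  have "{a [^] n | a. a \<in> N} \<subseteq> carrier G" by auto
  moreover have "g \<otimes> h \<otimes> inv g \<in> {a [^] n | a. a \<in> N}"
    if "h \<in> {a [^] n | a. a \<in> N}" "g \<in> carrier G" for h g
  proof -
    from that obtain a where a: "a \<in> N" "h = a [^] n" by auto
    then have "g \<otimes> h \<otimes> inv g = (g \<otimes> a \<otimes> inv g) [^] n" using that by (simp add: pow_conj)
    then show ?thesis using a that inv_op_closed2 by blast
  qed
  ultimately show ?thesis unfolding power_subgroup_def by (rule normal_generateI)
qed

end

section \<open>Centres, nilpotency and squares in finite 2-groups\<close>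

lemma (in group) finite_carrier_2_group: "order G = 2 ^ m \<Longrightarrow> finite (carrier G)"
  using order_gt_0_iff_finite by (metis zero_less_numeral zero_less_power)

text \<open>The class equation modulo 2: conjugacy classes have 2-power size, so if the identity
  were the only central element, every other class would be even and the group order odd.\<close>

lemma (in group) nontrivial_center_2_group:
  assumes "order G = 2 ^ m" "m > 0"
  obtains z where "z \<in> carrier G" "z \<noteq> \<one>" "\<And>g. g \<in> carrier G \<Longrightarrow> comm z g = \<one>"
proof (rule ccontr)
  assume "\<not> thesis"
  note noz = that
  define \<phi> where "\<phi> = (\<lambda>g. \<lambda>h \<in> carrier G. g \<otimes> h \<otimes> inv g)"
  interpret group_action G "carrier G" \<phi> unfolding \<phi>_def by (rule action_by_conjugation)
  have fin: "finite (carrier G)" by (rule finite_carrier_2_group[OF assms(1)])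
  define Os where "Os = orbits G (carrier G) \<phi>"
  have cov: "\<Union> Os = carrier G" unfolding Os_def by (rule orbits_coverture)
  have dis: "disjoint Os" unfolding Os_def disjoint_def using disjoint_union by blast
  have finO: "finite Os" using cov fin by (metis finite_UnionD)
  have one: "orbit G \<phi> \<one> = {\<one>}" unfolding orbit_def \<phi>_def using one_closed by force
  have even: "even (card B)" if B: "B \<in> Os - {{\<one>}}" for B
  proof -
    obtain x where x: "x \<in> carrier G" "B = orbit G \<phi> x" using B unfolding Os_def orbits_def by auto
    have "card B dvd 2 ^ m" using orbit_stabilizer_theorem[OF x(1)] x(2) assms(1) by (metis dvd_triv_left)
    then obtain k where k: "card B = 2 ^ k" using divides_primepow_nat two_is_prime_nat by blast
    have "k \<noteq> 0"
    proof
      assume "k = 0"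
      then obtain y where y: "B = {y}" using k card_1_singletonE by auto
      have orb: "g \<otimes> x \<otimes> inv g \<in> B" if "g \<in> carrier G" for g
        using x that unfolding orbit_def \<phi>_def by auto
      have "x = y" using orb[OF one_closed] x(1) y by simp
      have "comm x g = \<one>" if g: "g \<in> carrier G" for g
      proof -
        have "comm g x \<otimes> x = x" using comm_mult_conj[OF g x(1)] orb[OF g] y \<open>x = y\<close> by simp
        then have "comm g x = \<one>" using g x(1) by (metis comm_closed one_closed l_one r_cancel)
        then show ?thesis using comm_inv[OF g x(1)] by simp
      qed
      moreover have "x \<noteq> \<one>" using B x(2) one by auto
      ultimately show False using noz x(1) \<open>\<not> thesis\<close> by blast
    qed
    then show ?thesis using k by simp
  qed
  have "card (carrier G) = (\<Sum>B\<in>Os. card B)"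
    unfolding cov[symmetric] by (rule card_Union_disjoint) (use dis cov fin in \<open>auto intro: finite_subset\<close>)
  also have "{\<one>} \<in> Os" unfolding Os_def orbits_def using one one_closed by auto
  then have "(\<Sum>B\<in>Os. card B) = card {\<one>} + (\<Sum>B\<in>Os - {{\<one>}}. card B)" using finO by (rule sum.remove[rotated])
  finally have "odd (card (carrier G))" using dvd_sum[of "Os - {{\<one>}}" 2 card] even by auto
  then show False using assms unfolding order_def by simp
qed

text \<open>A nontrivial central element of G/V is lifted to G.\<close>

lemma (in group) center_mod_normal_2_group:
  assumes G: "order G = 2 ^ m" and V: "V \<lhd> G" "V \<noteq> carrier G"
  obtains x where "x \<in> carrier G" "x \<notin> V" "\<And>g. g \<in> carrier G \<Longrightarrow> comm x g \<in> V"
proof -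
  interpret V: normal V G by fact
  interpret Q: group "G Mod V" by (rule V.factorgroup_is_group)
  interpret h: group_hom G "G Mod V" "\<lambda>a. V #> a"
    by (simp add: V.r_coset_hom_Mod Q.is_group group_hom.intro group_hom_axioms.intro)
  have fin: "finite (carrier G)" by (rule finite_carrier_2_group[OF G])
  have lag: "card (rcosets V) * card V = 2 ^ m" using lagrange[OF V.subgroup_axioms] G by simp
  then obtain k where k: "card (rcosets V) = 2 ^ k"
    using divides_primepow_nat two_is_prime_nat by (metis dvd_triv_left)
  have "k \<noteq> 0"
  proof
    assume "k = 0"
    then have "card V = card (carrier G)" using k lag G by (simp add: order_def)
    then show False using V fin by (metis card_subset_eq V.subset)
  qed
  have "order (G Mod V) = 2 ^ k" using k by (simp add: order_def FactGroup_def)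
  then obtain z where z: "z \<in> carrier (G Mod V)" "z \<noteq> \<one>\<^bsub>G Mod V\<^esub>"
    "\<And>g. g \<in> carrier (G Mod V) \<Longrightarrow> Q.comm z g = \<one>\<^bsub>G Mod V\<^esub>"
    using Q.nontrivial_center_2_group \<open>k \<noteq> 0\<close> by (metis neq0_conv)
  obtain x where x: "x \<in> carrier G" "z = V #> x" using z(1) unfolding FactGroup_def RCOSETS_def by auto
  have "x \<notin> V" using z(2) x V.rcos_const by (auto simp: FactGroup_def)
  moreover have "comm x g \<in> V" if g: "g \<in> carrier G" for g
  proof -
    have "V #> comm x g = Q.comm z (V #> g)"
      using x g unfolding Q.comm_def comm_def by simp
    also have "\<dots> = V" using z(3) g h.hom_closed by (simp add: FactGroup_def)
    finally show ?thesis using x g by (metis rcos_self V.subgroup_axioms comm_closed)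
  qed
  ultimately show thesis using that x by blast
qed

text \<open>Nilpotency of finite 2-groups, as a rule: a set that lies in a normal subgroup as soon as its
  commutators do can be pushed all the way down.\<close>

lemma (in group) subset_normal_2_group:
  assumes G: "order G = 2 ^ m" and W: "W \<lhd> G" and D: "D \<subseteq> carrier G"
    and step: "\<And>V. V \<lhd> G \<Longrightarrow> W \<subseteq> V \<Longrightarrow> (\<And>d h. d \<in> D \<Longrightarrow> h \<in> carrier G \<Longrightarrow> comm d h \<in> V) \<Longrightarrow> D \<subseteq> V"
  shows "D \<subseteq> W"
proof (rule ccontr)
  assume nD: "\<not> D \<subseteq> W"
  have fin: "finite (carrier G)" by (rule finite_carrier_2_group[OF G])
  define P where "P = (\<lambda>V. V \<lhd> G \<and> W \<subseteq> V \<and> \<not> D \<subseteq> V)"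
  have bound: "\<And>V. P V \<Longrightarrow> card V \<le> card (carrier G)"
    unfolding P_def by (meson card_mono fin normal_imp_subgroup subgroup.subset)
  have "P W" using nD W by (simp add: P_def)
  \<comment> \<open>\<open>V\<close> is a largest normal subgroup that contains \<open>W\<close> but
    not \<open>D\<close>. The preimage \<open>C\<close> of the centre of G/V is strictly larger, so
    it contains \<open>D\<close>; then \<open>step\<close> forces \<open>D\<close> into
    \<open>V\<close>.\<close>
  then obtain V where V: "P V" and max: "\<And>U. P U \<Longrightarrow> card U \<le> card V"
    using ex_has_greatest_nat[of P W card "card (carrier G) + 1"] bound by fastforce
  have VG: "V \<lhd> G" "V \<noteq> carrier G" using V D by (auto simp: P_def)
  define C where "C = {x \<in> carrier G. \<forall>g\<in>carrier G. comm x g \<in> V}"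
  have C: "C \<lhd> G" unfolding C_def by (rule centralizer_mod_normal[OF VG(1)])
  have "V \<subseteq> C" unfolding C_def using comm_in_normal[OF VG(1)] VG(1)
    by (auto dest!: normal_imp_subgroup subgroup.mem_carrier)
  moreover obtain x where "x \<in> carrier G" "x \<notin> V" "\<And>g. g \<in> carrier G \<Longrightarrow> comm x g \<in> V"
    using center_mod_normal_2_group[OF G VG] by metis
  then have "C \<noteq> V" by (auto simp: C_def)
  moreover have "finite C" using fin by (simp add: C_def)
  ultimately have "card V < card C" by (intro psubset_card_mono) auto
  then have "\<not> P C" using max by fastforce
  then have "D \<subseteq> C" using C V \<open>V \<subseteq> C\<close> by (auto simp: P_def)
  then have "D \<subseteq> V" using step[of V] V by (auto simp: P_def C_def)
  then show False using V by (simp add: P_def)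
qed

text \<open>A nontrivial 2-group H has a subgroup M of index 2 by Sylow's theorem. For x outside M,
  H is the union of M and Mx, and x^2 cannot lie in Mx; hence M contains all squares.\<close>

lemma (in group) squares_proper_2_group:
  assumes G: "order G = 2 ^ m" and H: "subgroup H G" and eq: "power_subgroup G H 2 = H"
  shows "H = {\<one>}"
proof (rule ccontr)
  assume ne: "H \<noteq> {\<one>}"
  interpret H: subgroup H G by fact
  interpret K: group "G\<lparr>carrier := H\<rparr>" by (rule H.subgroup_is_group) (rule is_group)
  have fin: "finite (carrier G)" by (rule finite_carrier_2_group[OF G])
  have finH: "finite H" using fin H.subset finite_subset by blast
  have "card H dvd 2 ^ m" using lagrange[OF H] G by (metis dvd_triv_right)
  then obtain k where k: "card H = 2 ^ k" using divides_primepow_nat two_is_prime_nat by blast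
  have "k \<noteq> 0" using k ne H.one_closed card_1_singletonE by (metis power_0 singletonD)
  then have "order (G\<lparr>carrier := H\<rparr>) = 2 ^ (k - 1) * 2" using k by (simp add: order_def power_eq_if)
  then obtain M where M: "subgroup M (G\<lparr>carrier := H\<rparr>)" "card M = 2 ^ (k - 1)"
    using sylow_thm[OF two_is_prime_nat K.is_group, of "k-1" 2] finH by auto
  have MG: "subgroup M G" using M(1) H subgroup.subgroup_is_group incl_subgroup by blast
  interpret M: subgroup M G by (rule MG)
  have MH: "M \<subseteq> H" using M(1) subgroup.subset by force
  have "x \<otimes> x \<in> M" if x: "x \<in> H" for x
  proof (rule ccontr)
    assume xx: "x \<otimes> x \<notin> M"
    have xG: "x \<in> carrier G" using x by simp
    have "x \<notin> M" using xx by auto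
    define Mx where "Mx = (\<lambda>y. y \<otimes> x) ` M"
    have inj: "inj_on (\<lambda>y. y \<otimes> x) M" using xG by (auto intro!: inj_onI)
    have "M \<inter> Mx = {}"
    proof -
      have False if "y \<in> M" "y \<otimes> x \<in> M" for y
      proof -
        have "inv y \<otimes> (y \<otimes> x) \<in> M" using that by blast
        then show False using \<open>x \<notin> M\<close> that xG by simp
      qed
      then show ?thesis by (auto simp: Mx_def)
    qed
    then have "card (M \<union> Mx) = card M + card Mx"
      using finH MH by (intro card_Un_disjoint) (auto simp: Mx_def intro: finite_subset)
    also have "\<dots> = card H" using M(2) k card_image[OF inj] \<open>k \<noteq> 0\<close> by (simp add: Mx_def power_eq_if)
    finally have "M \<union> Mx = H" using finH MH x by (intro card_subset_eq) (auto simp: Mx_def)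
    then have "x \<otimes> x \<in> Mx" using H.m_closed[OF x x] xx by blast
    then obtain y where "y \<in> M" "x \<otimes> x = y \<otimes> x" by (auto simp: Mx_def)
    then show False using \<open>x \<notin> M\<close> xG by simp
  qed
  then have "power_subgroup G H 2 \<subseteq> M"
    unfolding power_subgroup_two[OF H.subset] by (intro generate_subgroup_incl[OF _ MG]) blast
  then have "card H \<le> card M" using eq finH MH by (metis card_mono finite_subset)
  moreover have "card M < card H" unfolding k M(2) using \<open>k \<noteq> 0\<close> by (intro power_strict_increasing) auto
  ultimately show False by simp
qed

lemma (in group) derived_eq_comm:
  "H \<subseteq> carrier G \<Longrightarrow> derived G H = generate G {comm x y | x y. x \<in> H \<and> y \<in> H}"
  unfolding derived_def comm_def by (rule arg_cong[where f = "generate G"]) blast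

section \<open>The series of iterated squares of a powerful 2-group\<close>

locale powerful_group = group +
  assumes powerful: "powerful_2_group G"
begin

primrec P :: "nat \<Rightarrow> 'a set" where
  "P 0 = carrier G"
| "P (Suc m) = power_subgroup G (P m) 2"

declare P.simps(2) [simp del]

lemma order_eq: "\<exists>m. order G = 2 ^ m"
  using powerful by (simp add: powerful_2_group_def finite_2_group_def)

lemma finite_carrier: "finite (carrier G)"
  using order_eq finite_carrier_2_group by blast

lemma P_normal: "P m \<lhd> G"
proof (induction m)
  case 0
  have "subgroup (carrier G) G" by (rule subgroup_self)
  then show ?case by (simp add: normal_inv_iff)
qed (simp add: P.simps power_subgroup_normal)

lemma P_subgroup: "subgroup (P m) G"
  using P_normal normal_imp_subgroup by blast

lemma P_carrier: "x \<in> P m \<Longrightarrow> x \<in> carrier G"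
  using P_subgroup by (rule subgroup.mem_carrier)

lemma P_mult: "x \<in> P m \<Longrightarrow> y \<in> P m \<Longrightarrow> x \<otimes> y \<in> P m"
  using P_subgroup by (rule subgroup.m_closed)

lemma P_inv: "x \<in> P m \<Longrightarrow> inv x \<in> P m"
  using P_subgroup by (rule subgroup.m_inv_closed)

lemma P_conj: "x \<in> P m \<Longrightarrow> g \<in> carrier G \<Longrightarrow> g \<otimes> x \<otimes> inv g \<in> P m"
  using P_normal by (rule normal.inv_op_closed2)

lemma P_Suc_generate: "P (Suc m) = generate G {a \<otimes> a | a. a \<in> P m}"
  by (simp add: P.simps power_subgroup_two subsetI P_carrier)

lemma P_square: "x \<in> P m \<Longrightarrow> x \<otimes> x \<in> P (Suc m)"
  unfolding P_Suc_generate by (blast intro: generate.incl)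

lemma P_Suc_subset: "P (Suc m) \<subseteq> P m"
  unfolding P_Suc_generate
  by (rule generate_subgroup_incl[OF _ P_subgroup]) (blast intro: P_mult)

lemma P_antimono: "m \<le> n \<Longrightarrow> P n \<subseteq> P m"
  by (rule lift_Suc_antimono_le[of P]) (rule P_Suc_subset)

text \<open>As long as no term is trivial, the cardinalities drop strictly at every step.\<close>

lemma P_eventually_trivial: "\<exists>e. P e = {\<one>}"
proof (rule ccontr)
  assume ne: "\<nexists>e. P e = {\<one>}"
  obtain k where k: "order G = 2 ^ k" using order_eq by blast
  have "P (Suc m) \<subset> P m" for m
    using P_Suc_subset[of m] ne squares_proper_2_group[OF k P_subgroup[of m]] by (auto simp: P.simps)
  then have less: "card (P (Suc m)) < card (P m)" for m
    using finite_carrier P_subgroup[of m]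
    by (meson finite_subset psubset_card_mono subgroup.subset)
  have "card (P m) + m \<le> card (P 0)" for m
  proof (induction m)
    case (Suc m)
    then show ?case using less[of m] by linarith
  qed simp
  from this[of "Suc (card (P 0))"] show False by simp
qed

text \<open>Induction on m. By \<open>subset_normal_2_group\<close> it suffices to work modulo a
  normal \<open>V\<close> containing \<open>P (m + 3)\<close> for which the commutators in question
  are already central. The hypothesis for m makes squares of commutators with \<open>P m\<close>
  vanish modulo \<open>V\<close>.\<close>

lemma comm_P: "x \<in> P m \<Longrightarrow> g \<in> carrier G \<Longrightarrow> comm x g \<in> P (m + 2)"
proof (induction m arbitrary: x g)
  case 0
  have "comm x g \<in> derived G (carrier G)"
    unfolding derived_eq_comm[OF subset_refl] using 0 by (auto intro: generate.incl)
  also have "\<dots> \<subseteq> power_subgroup G (carrier G) 4"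
    using powerful by (simp add: powerful_2_group_def)
  also have "\<dots> \<subseteq> P 2"
    unfolding power_subgroup_def
  proof (rule generate_subgroup_incl[OF _ P_subgroup], clarify)
    fix a assume a: "a \<in> carrier G"
    then have "a [^] (4::nat) = (a \<otimes> a) \<otimes> (a \<otimes> a)" by (simp add: eval_nat_numeral m_assoc)
    then show "a [^] (4::nat) \<in> P 2" using a P_square[of _ 0] P_square[of _ 1] by (simp add: numeral_2_eq_2)
  qed
  finally show ?case by (simp add: numeral_2_eq_2)
next
  case (Suc m)
  obtain k where k: "order G = 2 ^ k" using order_eq by blast
  define D where "D = {comm z h | z h. z \<in> P (Suc m) \<and> h \<in> carrier G}"
  have "D \<subseteq> P (m + 3)"
  proof (rule subset_normal_2_group[OF k P_normal])
    show "D \<subseteq> carrier G" by (auto simp: D_def P_carrier)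
    fix V assume V: "V \<lhd> G" "P (m + 3) \<subseteq> V"
      and DV: "\<And>d h. d \<in> D \<Longrightarrow> h \<in> carrier G \<Longrightarrow> comm d h \<in> V"
    interpret V: normal V G by (rule V(1))
    let ?C = "{x \<in> carrier G. \<forall>g\<in>carrier G. comm x g \<in> V}"
    have C: "subgroup ?C G" using centralizer_mod_normal[OF V(1)] normal_imp_subgroup by blast
    have square: "comm x g \<otimes> comm x g \<in> V" if "x \<in> P m" "g \<in> carrier G" for x g
      using P_square[OF Suc.IH[OF that]] V(2) by (auto simp: eval_nat_numeral)
    \<comment> \<open>First \<open>P (m + 2)\<close> is central modulo \<open>V\<close>: in [z^2,g]
      = [z,[z,g]] [z,g]^2 the first factor is controlled by \<open>DV\<close>, the second by
      \<open>square\<close>.\<close>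
    have "P (m + 2) \<subseteq> ?C"
      unfolding add_2_eq_Suc' P_Suc_generate[of "Suc m"]
    proof (rule generate_subgroup_incl[OF _ C], safe)
      fix z assume z: "z \<in> P (Suc m)"
      show "z \<otimes> z \<in> carrier G" using z P_carrier by blast
      fix g assume g: "g \<in> carrier G"
      have zG: "z \<in> carrier G" using z P_carrier by blast
      have "comm (comm z g) z \<in> V" using z g zG by (intro DV) (auto simp: D_def)
      then have "comm z (comm z g) \<in> V" using comm_inv[of "comm z g" z] zG g by (metis V.m_inv_closed comm_closed)
      then show "comm (z \<otimes> z) g \<in> V"
        using square[of z g] z P_Suc_subset zG g by (auto simp: comm_square_left)
    qed
    \<comment> \<open>The same identity one level up: now [x,g] need not be in \<open>D\<close>, but
      it lies in \<open>P (m + 2)\<close>, just shown to be central modulo \<open>V\<close>.\<close>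
    have "P (Suc m) \<subseteq> ?C"
      unfolding P_Suc_generate[of m]
    proof (rule generate_subgroup_incl[OF _ C], safe)
      fix x assume x: "x \<in> P m"
      show "x \<otimes> x \<in> carrier G" using x P_carrier by blast
      fix g assume g: "g \<in> carrier G"
      have xG: "x \<in> carrier G" using x P_carrier by blast
      have "comm (comm x g) x \<in> V" using Suc.IH[OF x g] \<open>P (m + 2) \<subseteq> ?C\<close> xG by blast
      then have "comm x (comm x g) \<in> V" using comm_inv[of "comm x g" x] xG g by (metis V.m_inv_closed comm_closed)
      then show "comm (x \<otimes> x) g \<in> V"
        using square[of x g] x xG g by (auto simp: comm_square_left)
    qed
    then show "D \<subseteq> V" by (auto simp: D_def)
  qed
  then show ?case using Suc.prems by (auto simp: D_def eval_nat_numeral)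
qed

lemma comm_P': "x \<in> P m \<Longrightarrow> g \<in> carrier G \<Longrightarrow> comm g x \<in> P (m + 2)"
  using comm_P[of x m g] comm_inv[of x g] P_inv P_carrier by metis

text \<open>The products a u^2 form a subgroup: u^2 v^2 differs from (uv)^2 by commutators, which
  \<open>comm_P\<close> puts into \<open>P (m + 2)\<close>. That subgroup contains the generators of
  \<open>P (Suc m)\<close>.\<close>

lemma P_square_mod:
  assumes "z \<in> P (Suc m)"
  shows "\<exists>a\<in>P (m + 2). \<exists>u\<in>P m. z = a \<otimes> (u \<otimes> u)"
proof -
  let ?B = "{a \<otimes> (u \<otimes> u) | a u. a \<in> P (m + 2) \<and> u \<in> P m}"
  have one: "\<one> \<in> P k" for k by (rule subgroup.one_closed[OF P_subgroup])
  have B: "subgroup ?B G"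
  proof (rule subgroupI)
    show "?B \<subseteq> carrier G" by (auto simp: P_carrier)
    show "?B \<noteq> {}" using one by blast
  next
    fix z assume "z \<in> ?B"
    then obtain a u where z: "z = a \<otimes> (u \<otimes> u)" "a \<in> P (m + 2)" "u \<in> P m" by blast
    have "a \<in> carrier G" "u \<in> carrier G" using z P_carrier by auto
    then have "inv z = (inv (u \<otimes> u) \<otimes> inv a \<otimes> inv (inv (u \<otimes> u))) \<otimes> (inv u \<otimes> inv u)"
      by (simp add: z(1) inv_mult_group m_assoc)
    moreover have "inv (u \<otimes> u) \<otimes> inv a \<otimes> inv (inv (u \<otimes> u)) \<in> P (m + 2)"
      using z \<open>u \<in> carrier G\<close> by (intro P_conj P_inv) auto
    moreover have "inv u \<in> P m" using z by (intro P_inv)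
    ultimately show "inv z \<in> ?B" by blast
  next
    fix z w assume "z \<in> ?B" "w \<in> ?B"
    then obtain a u b v where z: "z = a \<otimes> (u \<otimes> u)" "a \<in> P (m + 2)" "u \<in> P m"
      and w: "w = b \<otimes> (v \<otimes> v)" "b \<in> P (m + 2)" "v \<in> P m" by blast
    have car: "a \<in> carrier G" "u \<in> carrier G" "b \<in> carrier G" "v \<in> carrier G"
      using z w P_carrier by auto
    have "z \<otimes> w = a \<otimes> ((u \<otimes> u) \<otimes> b \<otimes> inv (u \<otimes> u)) \<otimes> ((u \<otimes> u) \<otimes> (v \<otimes> v))"
      using car by (simp add: z(1) w(1) inv_mult_group m_assoc)
    also have "\<dots> = (a \<otimes> ((u \<otimes> u) \<otimes> b \<otimes> inv (u \<otimes> u)) \<otimes> (comm u (comm u v) \<otimes> comm u v)) \<otimes> ((u \<otimes> v) \<otimes> (u \<otimes> v))"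
      unfolding square_mult[OF car(2,4)] using car by (simp add: m_assoc)
    also have "\<dots> \<in> ?B"
    proof -
      have "a \<otimes> ((u \<otimes> u) \<otimes> b \<otimes> inv (u \<otimes> u)) \<otimes> (comm u (comm u v) \<otimes> comm u v) \<in> P (m + 2)"
        using z w car by (intro P_mult P_conj comm_P) auto
      moreover have "u \<otimes> v \<in> P m" using z w P_mult by blast
      ultimately show ?thesis by blast
    qed
    finally show "z \<otimes> w \<in> ?B" .
  qed
  have "P (Suc m) \<subseteq> ?B"
    unfolding P_Suc_generate
  proof (rule generate_subgroup_incl[OF _ B], clarify)
    fix u assume "u \<in> P m"
    then show "\<exists>a v. u \<otimes> u = a \<otimes> (v \<otimes> v) \<and> a \<in> P (m + 2) \<and> v \<in> P m"
      using one[of "m + 2"] P_carrier by (intro exI[of _ \<one>] exI[of _ u]) auto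
  qed
  then show ?thesis using assms by blast
qed

text \<open>Successive approximation: the error a is itself v^2 up to a deeper error, with v in
  \<open>P (m + k)\<close>, and merging v^2 u^2 into (vu)^2 costs only commutators of v, of depth m
  + k + 2.\<close>

lemma P_square_approx:
  assumes "z \<in> P (Suc m)"
  shows "\<exists>a\<in>P (Suc m + k). \<exists>u\<in>P m. z = a \<otimes> (u \<otimes> u)"
proof (induction k)
  case 0
  have "\<one> \<in> P m" by (rule subgroup.one_closed[OF P_subgroup])
  then show ?case using assms P_carrier by (intro bexI[of _ z] bexI[of _ \<one>]) auto
next
  case (Suc k)
  then obtain a u where a: "a \<in> P (Suc (m + k))" and u: "u \<in> P m" and z: "z = a \<otimes> (u \<otimes> u)" by auto
  obtain b v where b: "b \<in> P (m + k + 2)" and v: "v \<in> P (m + k)" and a_eq: "a = b \<otimes> (v \<otimes> v)"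
    using P_square_mod[OF a] by blast
  have car: "b \<in> carrier G" "u \<in> carrier G" "v \<in> carrier G" using b u v P_carrier by auto
  have "z = b \<otimes> ((v \<otimes> v) \<otimes> (u \<otimes> u))" using car by (simp add: z a_eq m_assoc)
  also have "\<dots> = (b \<otimes> (comm v (comm v u) \<otimes> comm v u)) \<otimes> ((v \<otimes> u) \<otimes> (v \<otimes> u))"
    unfolding square_mult[OF car(3,2)] using car by (simp add: m_assoc)
  finally have "z = \<dots>" .
  moreover have "b \<otimes> (comm v (comm v u) \<otimes> comm v u) \<in> P (m + k + 2)"
    using b v car by (intro P_mult comm_P) auto
  moreover have "v \<otimes> u \<in> P m" using u v P_antimono[of m "m + k"] by (auto intro: P_mult)
  ultimately show ?case by auto
qed

text \<open>The error in \<open>P_square_approx\<close> is pushed into a trivial term of the series,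
  so elements of \<open>P (Suc m)\<close> are genuine squares and not just products of
  squares.\<close>

lemma P_root:
  assumes "x \<in> P (Suc m)" obtains u where "u \<in> P m" "u \<otimes> u = x"
proof -
  obtain e where e: "P e = {\<one>}" using P_eventually_trivial by blast
  obtain a u where "a \<in> P (Suc m + e)" "u \<in> P m" "x = a \<otimes> (u \<otimes> u)"
    using P_square_approx[OF assms] by blast
  then show thesis using that P_antimono[of e "Suc m + e"] e P_carrier by auto
qed

text \<open>Induction on l through a square root u of y: [x,y] is [x,u]^2 up to a conjugate of
  [u,[x,u]], whose depth is at least m + 2l + 4.\<close>

lemma comm_P_P: "x \<in> P m \<Longrightarrow> y \<in> P l \<Longrightarrow> comm x y \<in> P (m + l + 2)"
proof (induction l arbitrary: m x y)
  case 0
  then show ?case using comm_P by simp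
next
  case (Suc l)
  obtain u where u: "u \<in> P l" "u \<otimes> u = y" using P_root Suc.prems by blast
  have xG: "x \<in> carrier G" and uG: "u \<in> carrier G" using Suc.prems u P_carrier by auto
  have t: "comm x u \<in> P (m + l + 2)" using Suc u by blast
  have "comm (comm x u) u \<in> P (m + l + 2 + l + 2)" using Suc.IH[OF t u(1)] by (simp add: ac_simps)
  then have "comm u (comm x u) \<in> P (m + l + 2 + l + 2)"
    using comm_inv[of "comm x u" u] xG uG by (metis P_inv comm_closed)
  then have "comm u (comm x u) \<in> P (Suc (m + l + 2))" by (rule set_mp[OF P_antimono, rotated]) simp
  then have "comm x y \<in> P (Suc (m + l + 2))"
    unfolding u(2)[symmetric] comm_square_right[OF xG uG]
    using xG uG by (intro P_mult[OF P_conj P_square] t) auto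
  then show ?case by simp
qed

section \<open>Elements of bounded order at a given depth\<close>

lemma P_pow: "x \<in> P m \<Longrightarrow> x [^] ((2::nat) ^ s) \<in> P (m + s)"
proof (induction s)
  case (Suc s)
  then have "x [^] ((2::nat) ^ s) \<otimes> x [^] ((2::nat) ^ s) \<in> P (Suc (m + s))" using P_square by blast
  then show ?case using Suc.prems P_carrier by (simp add: nat_pow_mult mult_2)
qed (simp add: P_carrier)

text \<open>Merely a set at this stage; that it is a subgroup for m \<ge> 1 is
  \<open>T_subgroup\<close>, which needs the commutator bound.\<close>

definition T :: "nat \<Rightarrow> nat \<Rightarrow> 'a set" where
  "T s m = {x \<in> P m. x [^] ((2::nat) ^ s) = \<one>}"

lemma T_P: "x \<in> T s m \<Longrightarrow> x \<in> P m"
  by (simp add: T_def)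

lemma T_carrier: "x \<in> T s m \<Longrightarrow> x \<in> carrier G"
  using T_P P_carrier by blast

lemma T_zero: "x \<in> T 0 m \<Longrightarrow> x = \<one>"
  using P_carrier[of x m] by (auto simp: T_def)

lemma one_T: "\<one> \<in> T s m"
  by (simp add: T_def subgroup.one_closed[OF P_subgroup])

lemma pow_two_mono:
  assumes "x \<in> carrier G" "x [^] ((2::nat) ^ s) = \<one>" "s \<le> r"
  shows "x [^] ((2::nat) ^ r) = \<one>"
proof -
  have "x [^] ((2::nat) ^ r) = (x [^] ((2::nat) ^ s)) [^] ((2::nat) ^ (r - s))"
    using assms(1,3) by (simp add: nat_pow_pow power_add[symmetric])
  then show ?thesis using assms by simp
qed

lemma T_mono: "x \<in> T s m \<Longrightarrow> s \<le> r \<Longrightarrow> k \<le> m \<Longrightarrow> x \<in> T r k"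
  using P_antimono[of k m] pow_two_mono P_carrier by (auto simp: T_def)

lemma T_inv: "x \<in> T s m \<Longrightarrow> inv x \<in> T s m"
  using P_carrier[of x m] by (auto simp: T_def P_inv nat_pow_inv)

lemma T_conj: "x \<in> T s m \<Longrightarrow> g \<in> carrier G \<Longrightarrow> g \<otimes> x \<otimes> inv g \<in> T s m"
  using P_carrier[of x m] by (auto simp: T_def P_conj pow_conj)

lemma square_pow: "x \<in> carrier G \<Longrightarrow> (x \<otimes> x) [^] ((2::nat) ^ s) = x [^] ((2::nat) ^ Suc s)"
  using nat_pow_pow[of x 2 "2 ^ s"] by (simp add: numeral_2_eq_2)

lemma T_square: "x \<in> T s m \<Longrightarrow> x \<otimes> x \<in> T (s - 1) (Suc m)"
proof (cases s)
  case 0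
  assume "x \<in> T s m"
  then show ?thesis using 0 T_zero[of x m] one_T by simp
next
  case (Suc r)
  assume "x \<in> T s m"
  then show ?thesis using Suc P_square square_pow[of x r] P_carrier by (auto simp: T_def)
qed

text \<open>Taking roots preserves the sum of exponent and depth. This sum is the n that indexes
  \<open>comm_bound\<close>.\<close>

lemma T_root:
  assumes "x \<in> T s (Suc m)" obtains u where "u \<in> T (Suc s) m" "u \<otimes> u = x"
proof -
  obtain u where u: "u \<in> P m" "u \<otimes> u = x" using P_root assms T_P by blast
  then have "u \<in> T (Suc s) m" using assms square_pow[of u s] P_carrier by (simp add: T_def)
  then show thesis using that u by blast
qed

lemma T_comm_inv: "x \<in> carrier G \<Longrightarrow> y \<in> carrier G \<Longrightarrow> comm x y \<in> T s m \<Longrightarrow> comm y x \<in> T s m"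
  using T_inv[of "comm x y"] comm_inv by simp

section \<open>The commutator bound\<close>

text \<open>The subtractions truncate harmlessly: \<open>T 0 m\<close> is trivial, just as a negative exponent should be.\<close>

definition comm_bound :: "nat \<Rightarrow> bool" where
  "comm_bound n \<longleftrightarrow> (\<forall>m l x y. m \<ge> 1 \<longrightarrow> l \<ge> 1 \<longrightarrow> x \<in> T (n - m) m \<longrightarrow> y \<in> T (n - l) l \<longrightarrow>
     comm x y \<in> T (n - m - l) (m + l + 2))"

lemma comm_boundD:
  assumes "comm_bound n" "m \<ge> 1" "l \<ge> 1" "x \<in> T (n - m) m" "y \<in> T (n - l) l"
    "n - m - l \<le> s" "k \<le> m + l + 2"
  shows "comm x y \<in> T s k"
  using assms T_mono unfolding comm_bound_def by blast

text \<open>Induction on n - m by squaring: (xy)^2 is the product of x^2, a conjugate of [y,x] and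
  y^2. All three lie at depth m + 1 with exponent n - m - 1, the commutator by the bound and m \<ge>
  1.\<close>

lemma T_mult:
  assumes "comm_bound n" "m \<ge> 1" "x \<in> T (n - m) m" "y \<in> T (n - m) m"
  shows "x \<otimes> y \<in> T (n - m) m"
  using assms(2-)
proof (induction "n - m" arbitrary: m x y)
  case 0
  then have "x = \<one>" "y = \<one>" using T_zero[of _ m] by (metis)+
  then show ?case by (simp add: one_T)
next
  case (Suc d)
  have car: "x \<in> carrier G" "y \<in> carrier G" using Suc T_carrier by auto
  have d: "d = n - Suc m" "n - m - 1 = n - Suc m" "n - m = Suc (n - Suc m)" using Suc.hyps(2) by auto
  have "(x \<otimes> y) \<otimes> (x \<otimes> y) = (x \<otimes> x) \<otimes> (inv x \<otimes> comm y x \<otimes> inv (inv x)) \<otimes> (y \<otimes> y)"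
    using car by (simp add: comm_def m_assoc)
  also have "\<dots> \<in> T (n - Suc m) (Suc m)"
  proof -
    have "x \<otimes> x \<in> T (n - Suc m) (Suc m)" "y \<otimes> y \<in> T (n - Suc m) (Suc m)"
      using T_square Suc.prems d(2) by force+
    moreover have "inv x \<otimes> comm y x \<otimes> inv (inv x) \<in> T (n - Suc m) (Suc m)"
      by (rule T_conj[OF comm_boundD[OF assms(1)]]) (use Suc.prems car in auto)
    ultimately show ?thesis using Suc.hyps(1)[OF d(1)] by simp
  qed
  finally have "(x \<otimes> y) [^] ((2::nat) ^ (n - m)) = \<one>"
    using square_pow[of "x \<otimes> y"] car d(3) by (simp add: T_def)
  moreover have "x \<otimes> y \<in> P m" using Suc.prems by (intro P_mult T_P)
  ultimately show ?case by (simp add: T_def)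
qed

text \<open>Also covers an exponent truncated to 0, where s + m may miss n but the elements are
  trivial.\<close>

lemma T_mult':
  assumes "comm_bound n" "m \<ge> 1" "s + m = n \<or> s = 0" "x \<in> T s m" "y \<in> T s m"
  shows "x \<otimes> y \<in> T s m"
proof (cases "s = 0")
  case True
  then have "x = \<one>" "y = \<one>" using assms T_zero[of _ m] by auto
  then show ?thesis by (simp add: one_T)
next
  case False
  then have "s = n - m" using assms by auto
  then show ?thesis using T_mult assms by simp
qed

text \<open>The commutator has depth m + l + 2, and raising it to the stated power brings it to
  depth at least n + 2, where everything is trivial.\<close>

lemma comm_bound_large:
  assumes "P e = {\<one>}" "e \<le> n" shows "comm_bound n"
  unfolding comm_bound_def
proof (intro allI impI)
  fix m l x y
  assume *: "1 \<le> m" "1 \<le> l" "x \<in> T (n - m) m" "y \<in> T (n - l) l"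
  have c: "comm x y \<in> P (m + l + 2)" using * T_P comm_P_P by blast
  then have "comm x y [^] ((2::nat) ^ (n - m - l)) \<in> P (m + l + 2 + (n - m - l))" by (rule P_pow)
  also have "\<dots> \<subseteq> P e" by (rule P_antimono) (use assms in auto)
  finally show "comm x y \<in> T (n - m - l) (m + l + 2)" using c assms by (simp add: T_def)
qed

text \<open>Each of two squarings of v lowers the exponent of the commutator by one. The errors
  [v,[v,y]] and [v^2,[v^2,y]] obey the bound for s + q, and q \<ge> 3 makes them small enough. No
  order condition on y enters.\<close>

lemma comm_fourth_power:
  assumes C: "comm_bound (s + q)" and q: "q \<ge> 3" and v: "v \<in> T (s + 2) (q - 2)"
    and y: "y \<in> carrier G" and t: "comm v y \<in> T s q"
  shows "comm ((v \<otimes> v) \<otimes> (v \<otimes> v)) y \<in> T (s - 2) (q + 2)"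
proof -
  have vG: "v \<in> carrier G" using v T_carrier by blast
  let ?t = "comm v y" and ?t' = "comm (v \<otimes> v) y"
  have "comm v ?t \<in> T (s - 1) (q + 1)"
    by (rule comm_boundD[OF C, of "q - 2" q]) (use q v t in auto)
  moreover have "?t \<otimes> ?t \<in> T (s - 1) (q + 1)" using T_square[OF t] by simp
  ultimately have t': "?t' \<in> T (s - 1) (q + 1)"
    unfolding comm_square_left[OF vG y] using q by (intro T_mult'[OF C _ _ _ \<open>?t \<otimes> ?t \<in> _\<close>]) auto
  have vv: "v \<otimes> v \<in> T (s + 1) (q - 1)"
    using T_square[OF v] q by (simp add: Suc_diff_Suc numeral_2_eq_2)
  have "comm (v \<otimes> v) ?t' \<in> T (s - 2) (q + 2)"
    by (rule comm_boundD[OF C, of "q - 1" "q + 1"]) (use q t' vv in auto)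
  moreover have "?t' \<otimes> ?t' \<in> T (s - 2) (q + 2)" using T_square[OF t'] by (simp add: numeral_2_eq_2)
  ultimately show ?thesis
    unfolding comm_square_left[OF m_closed[OF vG vG] y] using q by (intro T_mult'[OF C _ _ _ \<open>?t' \<otimes> ?t' \<in> _\<close>]) auto
qed

text \<open>Powers of \<open>c \<otimes> y\<close> and \<open>y\<close> are compared by squaring both, which moves one level down. The
  required bound on the order of \<open>comm c y\<close> comes from taking for \<open>2 ^ s\<close> the largest order that occurs
  for any such \<open>c\<close>: it applies in particular to the commutator of \<open>y\<close> with a fourth root of \<open>c\<close>.\<close>

lemma left_factor_T:
  assumes C: "\<And>N. n < N \<Longrightarrow> comm_bound N" and q: "q \<ge> k + 2" "q \<ge> 3"
    and y: "y \<in> T (n - k) k" and c: "c \<in> P q" and cy: "c \<otimes> y \<in> T (n - k) k"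
  shows "c \<in> T (n - k) q"
  using q y c cy
proof (induction "n - k" arbitrary: k q y c)
  case 0
  then have "y = \<one>" "c \<otimes> y = \<one>" using T_zero[of _ k] by (metis)+
  then show ?case using P_carrier[OF \<open>c \<in> P q\<close>] one_T by simp
next
  case (Suc d)
  define Q where "Q = (\<lambda>s. \<forall>y c. y \<in> T (n - k) k \<longrightarrow> c \<in> P q \<longrightarrow> c \<otimes> y \<in> T (n - k) k \<longrightarrow> c \<in> T s q)"
  obtain r where "order G = 2 ^ r" using order_eq by blast
  then have "Q r" using pow_order_eq_1 P_carrier by (auto simp: Q_def T_def)
  define s where "s = (LEAST s. Q s)"
  have Qs: "Q s" unfolding s_def using \<open>Q r\<close> by (rule LeastI)
  have "s \<le> n - k"
  proof (rule ccontr)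
    assume s: "\<not> s \<le> n - k"
    then have s2: "s \<ge> 2" using Suc.hyps(2) by simp
    have "c \<in> T (s - 1) q" if y: "y \<in> T (n - k) k" and c: "c \<in> P q" and cy: "c \<otimes> y \<in> T (n - k) k" for y c
    proof -
      have cT: "c \<in> T s q" using Qs y c cy by (auto simp: Q_def)
      have q2: "q = Suc (Suc (q - 2))" using \<open>q \<ge> 3\<close> by simp
      obtain w where w: "w \<in> T (Suc s) (Suc (q - 2))" "w \<otimes> w = c" using T_root cT q2 by metis
      obtain v where v: "v \<in> T (s + 2) (q - 2)" "v \<otimes> v = w" using T_root[OF w(1)] by auto
      have car: "c \<in> carrier G" "y \<in> carrier G" "v \<in> carrier G" using cT y v T_carrier by auto
      \<comment> \<open>A conjugate of y, so the pair y and [v,y] again meets the conditions in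
        \<open>Q\<close>.\<close>
      have "comm v y \<otimes> y \<in> T (n - k) k" using comm_mult_conj T_conj[OF y] car by simp
      moreover have "comm v y \<in> P q"
        using comm_P_P[OF T_P[OF v(1)] T_P[OF y]] by (rule set_mp[OF P_antimono, rotated]) arith
      ultimately have "comm v y \<in> T s q" using Qs y by (auto simp: Q_def)
      \<comment> \<open>Here s + q exceeds n, because s > n - k and q \<ge> k + 2.\<close>
      then have e: "comm c y \<in> T (s - 2) (q + 2)"
        using comm_fourth_power[of s q v y] C[of "s + q"] s Suc.prems(1,2) v w car by auto
      define f where "f = c \<otimes> comm y c \<otimes> inv c"
      have f: "f \<in> T (s - 2) (q + 2)"
        unfolding f_def using T_conj[OF T_comm_inv[OF _ _ e]] car by simp
      \<comment> \<open>Next, f c^2 is a left factor of (cy)^2 = f c^2 y^2 relative to y^2, so the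
        induction hypothesis applies to it at level k + 1.\<close>
      have fG: "f \<in> carrier G" using f T_carrier by blast
      have "f \<otimes> (c \<otimes> c) \<otimes> (y \<otimes> y) = (c \<otimes> y) \<otimes> (c \<otimes> y)"
        using car by (simp add: f_def comm_def m_assoc)
      then have "f \<otimes> (c \<otimes> c) \<otimes> (y \<otimes> y) \<in> T (n - Suc k) (Suc k)"
        using T_square[OF cy] by simp
      moreover have "y \<otimes> y \<in> T (n - Suc k) (Suc k)" using T_square[OF y] by simp
      moreover have "f \<otimes> (c \<otimes> c) \<in> P (Suc q)"
        using P_square[OF c] T_P[OF f] P_antimono[of "Suc q" "q + 2"] by (auto intro: P_mult)
      ultimately have "f \<otimes> (c \<otimes> c) \<in> T (n - Suc k) (Suc q)"
        using Suc.hyps(1)[of "Suc k" "Suc q"] Suc.hyps(2) Suc.prems(1,2) by simp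
      then have 1: "f \<otimes> (c \<otimes> c) \<in> T (s - 2) (Suc q)" by (rule T_mono) (use s in auto)
      have 2: "inv f \<in> T (s - 2) (Suc q)" using T_inv[OF T_mono[OF f, of "s - 2" "Suc q"]] by simp
      \<comment> \<open>Cancelling f bounds the order of c^2 by 2^(s-2), hence that of c by 2^(s-1),
        contrary to the minimality of s.\<close>
      have "inv f \<otimes> (f \<otimes> (c \<otimes> c)) \<in> T (s - 2) (Suc q)"
        by (rule T_mult'[OF C _ _ 2 1, of "s - 2 + Suc q"]) (use s s2 Suc.prems(1) in auto)
      then have "(c \<otimes> c) [^] ((2::nat) ^ (s - 2)) = \<one>" using fG car by (simp add: T_def)
      moreover have "Suc (s - 2) = s - 1" using s2 by simp
      ultimately have "c [^] ((2::nat) ^ (s - 1)) = \<one>" unfolding square_pow[OF car(1)] by simp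
      then show ?thesis using c by (simp add: T_def)
    qed
    then have "Q (s - 1)" by (auto simp: Q_def)
    then have "s \<le> s - 1" unfolding s_def by (rule Least_le)
    then show False using s2 by simp
  qed
  moreover have "c \<in> T s q" using Qs Suc.prems by (auto simp: Q_def)
  ultimately show ?case using T_mono by blast
qed

text \<open>\<open>left_factor_T\<close> gives a weak estimate for commutators. It yields the case m
  = l = 1, from which square roots and symmetry reach all m and l.\<close>

lemma comm_bound_step:
  assumes C: "\<And>N. n < N \<Longrightarrow> comm_bound N"
  shows "comm_bound n"
proof -
  have A: "comm x g \<in> T (n - m) (m + 2)" if "m \<ge> 1" "x \<in> T (n - m) m" "g \<in> carrier G" for x g m
  proof -
    have xG: "x \<in> carrier G" using that T_carrier by blast
    have "comm g x \<in> T (n - m) (m + 2)"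
    proof (rule left_factor_T[OF C, where y = x])
      show "comm g x \<otimes> x \<in> T (n - m) m" using that xG T_conj comm_mult_conj by simp
      show "comm g x \<in> P (m + 2)" using comm_P' T_P that by blast
    qed (use that in auto)
    then show ?thesis using T_comm_inv that xG by blast
  qed
  \<comment> \<open>A variant of \<open>A\<close> for u of depth 0; the other entry must then lie in
    \<open>P 1\<close> so that the commutator has depth 3.\<close>
  have A0: "comm w u \<in> T n 3" if "w \<in> P 1" "u \<in> T n 0" for w u
  proof -
    have car: "w \<in> carrier G" "u \<in> carrier G" using that T_carrier P_carrier by blast+
    have "comm w u \<in> T (n - 0) 3"
    proof (rule left_factor_T[OF C, where y = u])
      show "comm w u \<otimes> u \<in> T (n - 0) 0" using that car T_conj comm_mult_conj by simp
      show "comm w u \<in> P 3" using comm_P[OF that(1) car(2)] by (simp add: numeral_3_eq_3)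
    qed (use that in auto)
    then show ?thesis by simp
  qed
  define R where "R = (\<lambda>m l. \<forall>x y. x \<in> T (n - m) m \<longrightarrow> y \<in> T (n - l) l \<longrightarrow>
     comm x y \<in> T (n - m - l) (m + l + 2))"
  have sym: "R l m" if "R m l" for m l
    unfolding R_def
  proof (intro allI impI)
    fix x y assume *: "x \<in> T (n - l) l" "y \<in> T (n - m) m"
    then have "comm y x \<in> T (n - m - l) (m + l + 2)" using that by (auto simp: R_def)
    moreover have "n - m - l = n - l - m" "m + l + 2 = l + m + 2" by auto
    ultimately show "comm x y \<in> T (n - l - m) (l + m + 2)" using T_comm_inv * T_carrier by metis
  qed
  have one: "R 1 1"
    unfolding R_def
  proof (intro allI impI)
    fix x y assume x: "x \<in> T (n - 1) 1" and y: "y \<in> T (n - 1) 1"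
    show "comm x y \<in> T (n - 1 - 1) (1 + 1 + 2)"
    proof (cases "n = 0")
      case True
      then have "y = \<one>" using y T_zero by simp
      then show ?thesis using x T_carrier one_T by simp
    next
      case False
      obtain u where u: "u \<in> T n 0" "u \<otimes> u = y" using T_root[of y "n - 1" 0] y False by auto
      have car: "x \<in> carrier G" "u \<in> carrier G" using x u T_carrier by auto
      have t: "comm x u \<in> T (n - 1) 3" using A[OF _ x] car by (simp add: numeral_3_eq_3)
      obtain w' where w': "w' \<in> T n 2" "w' \<otimes> w' = comm x u"
        using T_root[of "comm x u" "n - 1" 2] t False by auto
      obtain w where w: "w \<in> T (n + 1) 1" "w \<otimes> w = w'" using T_root[of w' n 1] w' by (auto simp: numeral_2_eq_2)
      \<comment> \<open>The root u has depth 0, outside the reach of \<open>comm_bound\<close>.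
        Instead [x,u] is written as w^4 and \<open>comm_fourth_power\<close> is applied with s = n,
        q = 3.\<close>
      have "comm (comm x u) u \<in> T (n - 2) (3 + 2)"
        unfolding w'(2)[symmetric] w(2)[symmetric]
      proof (rule comm_fourth_power[OF C])
        show "w \<in> T (n + 2) (3 - 2)" using T_mono[OF w(1)] by simp
        show "comm w u \<in> T n 3" using A0 u w T_P by blast
      qed (use car in auto)
      then have "comm u (comm x u) \<in> T (n - 2) 5" using T_comm_inv car by simp
      then have 1: "comm x u \<otimes> comm u (comm x u) \<otimes> inv (comm x u) \<in> T (n - 2) 4"
        using T_mono[of _ "n - 2" 5 "n - 2" 4] T_conj car by simp
      have 2: "comm x u \<otimes> comm x u \<in> T (n - 2) 4" using T_square[OF t] by (simp add: numeral_2_eq_2)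
      have "comm x y \<in> T (n - 2) 4"
        unfolding u(2)[symmetric] comm_square_right[OF car]
        by (rule T_mult'[OF C[of "n + 2"] _ _ 1 2]) auto
      then show ?thesis by (simp add: eval_nat_numeral)
    qed
  qed
  have step: "R m (Suc l)" if m: "m \<ge> 1" and l: "l \<ge> 1" and IH: "R m l" for m l
    unfolding R_def
  proof (intro allI impI)
    fix x y assume x: "x \<in> T (n - m) m" and y: "y \<in> T (n - Suc l) (Suc l)"
    let ?s = "n - m - Suc l" and ?k = "m + Suc l + 2"
    show "comm x y \<in> T ?s ?k"
    proof (cases "n \<le> l")
      case True
      then have "y = \<one>" using y T_zero by simp
      then show ?thesis using x T_carrier one_T by simp
    next
      case False
      then obtain u where u: "u \<in> T (n - l) l" "u \<otimes> u = y"
        using T_root[of y "n - Suc l" l] y by (auto simp: Suc_diff_Suc)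
      have car: "x \<in> carrier G" "u \<in> carrier G" using x u T_carrier by auto
      have t: "comm x u \<in> T (n - m - l) (m + l + 2)" using IH x u by (auto simp: R_def)
      \<comment> \<open>Exponent and depth of [x,u] add up to n + 2 unless the exponent is
        truncated, so the bound already known for n + 2 applies.\<close>
      have "comm u (comm x u) \<in> T ?s ?k"
      proof (rule comm_boundD[OF C[of "n + 2"]])
        show "u \<in> T (n + 2 - l) l" using T_mono[OF u(1)] by simp
        show "comm x u \<in> T (n + 2 - (m + l + 2)) (m + l + 2)" using t by simp
      qed (use l m in auto)
      then have 1: "comm x u \<otimes> comm u (comm x u) \<otimes> inv (comm x u) \<in> T ?s ?k"
        using T_conj car by simp
      have 2: "comm x u \<otimes> comm x u \<in> T ?s ?k" using T_square[OF t] by simp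
      show ?thesis
        unfolding u(2)[symmetric] comm_square_right[OF car]
        by (rule T_mult'[OF C[of "n + 2"] _ _ 1 2]) auto
    qed
  qed
  have R1: "R 1 l" if "l \<ge> 1" for l
    using that by (induction l rule: dec_induct) (use one step in auto)
  \<comment> \<open>Induction on l for fixed m; the start \<open>R m 1\<close> is
    \<open>R 1 m\<close> by symmetry.\<close>
  have "R m l" if m: "m \<ge> 1" and "l \<ge> 1" for m l
    using that(2) by (induction l rule: dec_induct) (use sym[OF R1[OF m]] step[OF m] in auto)
  then show ?thesis by (auto simp: comm_bound_def R_def)
qed

lemma comm_bound: "comm_bound n"
proof -
  obtain e where e: "P e = {\<one>}" using P_eventually_trivial by blast
  show ?thesis
  proof (induction "e - n" arbitrary: n rule: less_induct)
    case less
    show ?case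
    proof (cases "e \<le> n")
      case True
      then show ?thesis using comm_bound_large e by blast
    next
      case False
      have "comm_bound N" if "n < N" for N using less[of N] that False by auto
      then show ?thesis by (rule comm_bound_step)
    qed
  qed
qed

section \<open>Omega subgroups and powerfully central chains\<close>

lemma T_subgroup: "m \<ge> 1 \<Longrightarrow> subgroup (T s m) G"
  using T_carrier one_T T_inv T_mult'[OF comm_bound[of "s + m"], of m s]
  by (intro subgroupI) blast+

lemma comm_T:
  assumes "m \<ge> 1" "x \<in> T s m" "y \<in> T s m" shows "comm x y \<in> T (s - m) (2 * m + 2)"
  by (rule comm_boundD[OF comm_bound[of "s + m"] assms(1,1)]) (use assms in auto)

lemma P_iterated_root:
  assumes "x \<in> P m" obtains a where "a \<in> carrier G" "a [^] ((2::nat) ^ m) = x"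
proof -
  have "\<exists>a\<in>carrier G. a [^] ((2::nat) ^ m) = x" using assms
  proof (induction m arbitrary: x)
    case (Suc m)
    then obtain u where u: "u \<in> P m" "u \<otimes> u = x" using P_root by blast
    then obtain a where "a \<in> carrier G" "a [^] ((2::nat) ^ m) = u" using Suc.IH by blast
    then show ?case using u by (intro bexI[of _ a]) (auto simp: nat_pow_mult mult_2)
  qed auto
  then show thesis using that by blast
qed

lemma power_subgroup_eq_P: "power_subgroup G (carrier G) (2 ^ j) = P j"
proof
  show "power_subgroup G (carrier G) (2 ^ j) \<subseteq> P j"
    unfolding power_subgroup_def using P_pow[of _ 0 j]
    by (intro generate_subgroup_incl[OF _ P_subgroup]) auto
  show "P j \<subseteq> power_subgroup G (carrier G) (2 ^ j)"
    unfolding power_subgroup_def by (auto elim!: P_iterated_root intro: generate.incl)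
qed

text \<open>The generating set of \<open>Omega\<close> is \<open>T i j\<close>, already a subgroup,
  so generation adds no elements of larger order.\<close>

lemma Omega_eq_T:
  assumes "j \<ge> 1"
  shows "Omega i (power_group G (2 ^ j)) = G\<lparr>carrier := T i j\<rparr>"
proof -
  let ?H = "G\<lparr>carrier := P j\<rparr>"
  interpret H: group ?H using subgroup.subgroup_is_group[OF P_subgroup is_group] .
  have "{x \<in> carrier ?H. group.ord ?H x dvd 2 ^ i} = T i j"
    using H.pow_eq_id[of _ "2 ^ i"] by (auto simp: T_def nat_pow_consistent[symmetric])
  moreover have "subgroup (T i j) ?H"
    by (rule subgroup_incl[OF T_subgroup[OF assms] P_subgroup]) (auto simp: T_P)
  then have "generate ?H (T i j) = T i j"
    using H.generate_subgroup_incl[of "T i j" "T i j"] by (auto intro: generate.incl)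
  ultimately show ?thesis
    unfolding Omega_def power_group_def power_subgroup_eq_P by simp
qed

lemma P_trivial_of_exponent:
  assumes "\<And>x. x \<in> carrier G \<Longrightarrow> x [^] ((2::nat) ^ i) = \<one>"
  shows "P i = {\<one>}"
  using assms subgroup.one_closed[OF P_subgroup] by (auto elim!: P_iterated_root)

text \<open>The series in reverse, jumping from \<open>P (i - 2)\<close> straight to the trivial
  group. Leaving out \<open>P (i - 1)\<close> is what gives length i - 1 instead of i.\<close>

lemma powerfully_central_chain_P:
  assumes "P i = {\<one>}" "i \<ge> 2"
  shows "powerfully_central_chain G (i - 1) (\<lambda>k. if k = 0 then {\<one>} else P (i - 1 - k))"
    (is "powerfully_central_chain G _ ?H")
  unfolding powerfully_central_chain_def
proof (intro conjI ballI)
  show "?H (i - 1) = carrier G" using assms by simp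
  show "subgroup (?H k) G" for k using P_subgroup triv_subgroup by simp
  fix k assume k: "k \<in> {1..i - 1}"
  show "?H (k - 1) \<subseteq> ?H k"
    using k P_antimono[of "i - 1 - k" "i - 1 - (k - 1)"] subgroup.one_closed[OF P_subgroup] by auto
  have sub: "?H (k - 1) \<subseteq> carrier G" using P_carrier by auto
  have "comm x y \<in> power_subgroup G (?H (k - 1)) 2" if x: "x \<in> ?H k" and y: "y \<in> carrier G" for x y
  \<comment> \<open>The jump: commutators of \<open>P (i - 2)\<close> lie in \<open>P i\<close>,
    which is trivial. In the other case they lie in the squares of the preceding term.\<close>
  proof (cases "k = 1")
    case True
    have "comm x y \<in> P (i - 1 - k + 2)" using x y k comm_P by auto
    then have "comm x y = \<one>" using True assms by (auto simp: numeral_2_eq_2 Suc_diff_Suc)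
    then show ?thesis unfolding power_subgroup_def by (simp add: generate.one)
  next
    case False
    then have "power_subgroup G (?H (k - 1)) 2 = P (Suc (i - 1 - (k - 1)))"
      using k by (auto simp: P.simps(2))
    also have "Suc (i - 1 - (k - 1)) = i - 1 - k + 2" using k by auto
    finally show ?thesis using x y k comm_P by auto
  qed
  then show "commutator_subgroup G (?H k) (carrier G) \<subseteq> power_subgroup G (?H (k - 1)) 2"
    unfolding commutator_subgroup_def comm_def[symmetric]
    by (intro generate_subgroup_incl) (use sub in \<open>auto simp: power_subgroup_def intro!: generate_is_subgroup\<close>)
qed auto

lemma powerful_T:
  assumes j: "j \<ge> 2"
  shows "powerful_2_group (G\<lparr>carrier := T i j\<rparr>)"
proof -
  let ?K = "G\<lparr>carrier := T i j\<rparr>"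
  have sub: "subgroup (T i j) G" using T_subgroup j by simp
  interpret K: group ?K using subgroup.subgroup_is_group[OF sub is_group] .
  obtain m where m: "order G = 2 ^ m" using order_eq by blast
  then have "card (T i j) dvd 2 ^ m" using lagrange[OF sub] by (metis dvd_triv_right)
  then obtain k where "card (T i j) = 2 ^ k" using divides_primepow_nat two_is_prime_nat by blast
  then have "finite_2_group ?K" using K.is_group by (auto simp: finite_2_group_def order_def)
  moreover have "K.comm x y \<in> power_subgroup ?K (T i j) 4" if x: "x \<in> T i j" and y: "y \<in> T i j" for x y
  proof -
    have "K.comm x y = comm x y"
      unfolding K.comm_def comm_def using x y by (simp add: m_inv_consistent[OF sub])
    \<comment> \<open>Since j \<ge> 2, both the exponent i - j and the depth 2j + 2 of
      \<open>comm_T\<close> suffice. Two square roots then lead back into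
      \<open>T i j\<close>.\<close>
    also have "comm x y \<in> T (i - 2) (j + 2)"
      using T_mono[OF comm_T[OF _ x y], of "i - 2" "j + 2"] j by auto
    then obtain w where "w \<in> T i j" "w [^] (4::nat) = comm x y"
    proof (cases "i \<ge> 2")
      case True
      obtain v where v: "v \<in> T (Suc (i - 2)) (j + 1)" "v \<otimes> v = comm x y"
        using T_root[of "comm x y" "i - 2" "j + 1"] \<open>comm x y \<in> T (i - 2) (j + 2)\<close> by auto
      obtain w where w: "w \<in> T (Suc (Suc (i - 2))) j" "w \<otimes> w = v"
        using T_root[of v "Suc (i - 2)" j] v by auto
      have "w [^] (4::nat) = comm x y"
        using w v T_carrier by (auto simp: eval_nat_numeral m_assoc)
      then show thesis using that w(1) True by (simp add: numeral_2_eq_2 Suc_diff_Suc)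
    next
      case False
      then have "comm x y = \<one>" using \<open>comm x y \<in> T (i - 2) (j + 2)\<close> T_zero by simp
      then show thesis using that[of \<one>] one_T by simp
    qed
    then have "comm x y \<in> power_subgroup ?K (T i j) 4"
      unfolding power_subgroup_def by (force intro: generate.incl simp: nat_pow_consistent[symmetric])
    finally show ?thesis .
  qed
  then have "derived ?K (carrier ?K) \<subseteq> power_subgroup ?K (carrier ?K) 4"
    unfolding K.derived_eq_comm[OF subset_refl]
    by (intro K.generate_subgroup_incl) (auto simp: power_subgroup_def intro!: K.generate_is_subgroup)
  ultimately show ?thesis by (simp add: powerful_2_group_def)
qed

end

theorem theorem14:
  fixes G :: "('a, 'b) monoid_scheme" and i j :: nat
  assumes "powerful_2_group G" and "i \<ge> 1" and "j \<ge> 2"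
  shows "powerfully_nilpotent (Omega i (power_group G (2 ^ j)))
    \<and> (i > 1 \<longrightarrow> powerful_nilpotency_class (Omega i (power_group G (2 ^ j))) \<le> i - 1)
    \<and> (i = 1 \<longrightarrow> powerful_nilpotency_class (Omega i (power_group G (2 ^ j))) =
         (if carrier (Omega i (power_group G (2 ^ j))) = {\<one>\<^bsub>G\<^esub>} then 0 else 1))"
proof -
  interpret powerful_group G
    using assms(1) by (auto simp: powerful_group_def powerful_group_axioms_def powerful_2_group_def finite_2_group_def)
  define K where "K = Omega i (power_group G (2 ^ j))"
  have K: "K = G\<lparr>carrier := T i j\<rparr>" unfolding K_def using Omega_eq_T assms(3) by simp
  have pK: "powerful_2_group K" unfolding K using powerful_T assms(3) .
  interpret K: powerful_group K
    using pK by (auto simp: powerful_group_def powerful_group_axioms_def powerful_2_group_def finite_2_group_def)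
  \<comment> \<open>The maximum merges i = 1 with i = 2: exponent 2 is treated as exponent 4, giving
    a chain of length 1.\<close>
  have exponent: "x [^]\<^bsub>K\<^esub> ((2::nat) ^ max i 2) = \<one>\<^bsub>K\<^esub>" if "x \<in> carrier K" for x
    by (rule K.pow_two_mono[of x i]) (use that in \<open>auto simp: K T_def nat_pow_consistent[symmetric]\<close>)
  have "K.P (max i 2) = {\<one>\<^bsub>K\<^esub>}" using exponent by (rule K.P_trivial_of_exponent)
  then obtain H where chain: "powerfully_central_chain K (max i 2 - 1) H"
    using K.powerfully_central_chain_P by fastforce
  then have "powerfully_nilpotent K" using pK by (auto simp: powerfully_nilpotent_def)
  moreover have le: "powerful_nilpotency_class K \<le> max i 2 - 1"
    unfolding powerful_nilpotency_class_def using chain by (intro Least_le) blast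
  \<comment> \<open>For i = 1 the class is at most 1, so it equals 1 once class 0 is confined to the
    trivial group.\<close>
  moreover have "powerful_nilpotency_class K = 0 \<longleftrightarrow> carrier K = {\<one>\<^bsub>K\<^esub>}"
  proof
    assume "powerful_nilpotency_class K = 0"
    moreover have "\<exists>H. powerfully_central_chain K (powerful_nilpotency_class K) H"
      unfolding powerful_nilpotency_class_def by (rule LeastI_ex) (use chain in blast)
    ultimately show "carrier K = {\<one>\<^bsub>K\<^esub>}" by (auto simp: powerfully_central_chain_def)
  next
    assume "carrier K = {\<one>\<^bsub>K\<^esub>}"
    then have "powerfully_central_chain K 0 (\<lambda>_. {\<one>\<^bsub>K\<^esub>})"
      using K.subgroup_self by (simp add: powerfully_central_chain_def)
    then have "powerful_nilpotency_class K \<le> 0"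
      unfolding powerful_nilpotency_class_def by (intro Least_le) blast
    then show "powerful_nilpotency_class K = 0" by simp
  qed
  moreover have "\<one>\<^bsub>K\<^esub> = \<one>\<^bsub>G\<^esub>" by (simp add: K)
  ultimately show ?thesis unfolding K_def[symmetric] by auto
qed

end
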